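(* Let $G=(V,E)$ be a locally finite simple graph and $x\in V$. Then $G$ is $S_1$-out regular at $x$ if and only if there exists $\mathcal N\in(0,\infty]$ such that $x$ is $\mathcal N$-curvature sharp.
   Context: Graphs are undirected, without loops or multiple edges, and every vertex has finite degree; $d_x$ is the degree of $x$, and the vertex $x$ considered has $d_x\ge1$. For $f:V\to\mathbb R$ put $\Delta f(x)=\sum_{y\sim x}(f(y)-f(x))$ (non-normalized Laplacian), and for $f,g:V\to\mathbb R$ put $2\Gamma(f,g)=\Delta(fg)-f\Delta g-g\Delta f$, $2\Gamma_2(f,g)=\Delta\Gamma(f,g)-\Gamma(f,\Delta g)-\Gamma(\Delta f,g)$, $\Gamma(f)=\Gamma(f,f)$, $\Gamma_2(f)=\Gamma_2(f,f)$. For $\mathcal N\in(0,\infty]$ (convention $1/\infty=0$), $\mathcal K_{G,x}(\mathcal N)$ is the largest $K\in\mathbb R$ such that $\Gamma_2(f)(x)\ge\frac1{\mathcal N}(\Delta f(x))^2+K\,\Gamma(f)(x)$ for all $f:V\to\mathbb R$ (Bakry-Émery curvature function). $S_1(x)$ is the set of neighbours of $x$. For $y\in S_1(x)$, the out degree $d_y^+$ is the number of neighbours of $y$ at graph distance $2$ from $x$; $av_1^+(x)=\frac1{d_x}\sum_{y\in S_1(x)}d_y^+$; and $\mathcal K_\infty^0(x)=\frac{3+d_x-av_1^+(x)}2$. $G$ is $S_1$-out regular at $x$ if all vertices of $S_1(x)$ have the same out degree. The vertex $x$ is $\mathcal N$-curvature sharp if $\mathcal K_{G,x}(\mathcal N)=\mathcal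 K_\infty^0(x)-\frac{2d_x}{\mathcal N}$. *)

theory Defs
  imports "HOL-Analysis.Analysis"
begin

definition neighbours :: "'a set set \<Rightarrow> 'a \<Rightarrow> 'a set" where
  "neighbours E x = {y. {x, y} \<in> E}"

definition vertex_degree :: "'a set set \<Rightarrow> 'a \<Rightarrow> nat" where
  "vertex_degree E x = card (neighbours E x)"

locale locally_finite_graph =
  fixes V :: "'a set" and E :: "'a set set"
  assumes edges: "e \<in> E \<Longrightarrow> e \<subseteq> V \<and> card e = 2"
    and finite_neighbours: "x \<in> V \<Longrightarrow> finite (neighbours E x)"

text \<open>The infimum of all walk lengths; it is \<open>\<infinity>\<close> when there is no walk.\<close>

definition graph_distance :: "'a set set \<Rightarrow> 'a \<Rightarrow> 'a \<Rightarrow> enat" where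
  "graph_distance E x y = (INF n \<in> {n. (x, y) \<in> {(u, v). {u, v} \<in> E} ^^ n}. enat n)"

text \<open>Functions on the vertex set \<open>V\<close> are represented by functions on the whole type.
  Their values outside \<open>V\<close> play no role at vertices of \<open>V\<close>, as all neighbours lie in \<open>V\<close>.\<close>

definition laplacian :: "'a set set \<Rightarrow> ('a \<Rightarrow> real) \<Rightarrow> 'a \<Rightarrow> real" where
  "laplacian E f x = (\<Sum>y\<in>neighbours E x. f y - f x)"

definition Gamma1 :: "'a set set \<Rightarrow> ('a \<Rightarrow> real) \<Rightarrow> ('a \<Rightarrow> real) \<Rightarrow> 'a \<Rightarrow> real" where
  "Gamma1 E f g x =
    (laplacian E (\<lambda>y. f y * g y) x - f x * laplacian E g x - g x * laplacian E f x) / 2"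

definition Gamma2 :: "'a set set \<Rightarrow> ('a \<Rightarrow> real) \<Rightarrow> ('a \<Rightarrow> real) \<Rightarrow> 'a \<Rightarrow> real" where
  "Gamma2 E f g x =
    (laplacian E (Gamma1 E f g) x - Gamma1 E f (laplacian E g) x
      - Gamma1 E (laplacian E f) g x) / 2"

text \<open>The dimension parameter \<open>N\<close> ranges over the positive extended reals;
  \<open>1 / \<infinity> = 0\<close> holds in \<open>ereal\<close>, so \<open>1 / N\<close> is then always finite.\<close>

definition curvature_dimension :: "'a set set \<Rightarrow> 'a \<Rightarrow> real \<Rightarrow> ereal \<Rightarrow> bool" where
  "curvature_dimension E x K N \<longleftrightarrow>
    (\<forall>f :: 'a \<Rightarrow> real. Gamma2 E f f x
      \<ge> real_of_ereal (1 / N) * (laplacian E f x)\<^sup>2 + K * Gamma1 E f f x)"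

definition curvature :: "'a set set \<Rightarrow> 'a \<Rightarrow> ereal \<Rightarrow> real" where
  "curvature E x N = (GREATEST K. curvature_dimension E x K N)"

definition out_degree :: "'a set set \<Rightarrow> 'a \<Rightarrow> 'a \<Rightarrow> nat" where
  "out_degree E x y = card {z \<in> neighbours E y. graph_distance E x z = 2}"

definition average_out_degree :: "'a set set \<Rightarrow> 'a \<Rightarrow> real" where
  "average_out_degree E x =
    (\<Sum>y\<in>neighbours E x. real (out_degree E x y)) / real (vertex_degree E x)"

definition upper_curvature_bound :: "'a set set \<Rightarrow> 'a \<Rightarrow> real" where
  "upper_curvature_bound E x = (3 + real (vertex_degree E x) - average_out_degree E x) / 2"

definition S1_out_regular :: "'a set set \<Rightarrow> 'a \<Rightarrow> bool" where
  "S1_out_regular E x \<longleftrightarrow>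
    (\<forall>y\<in>neighbours E x. \<forall>z\<in>neighbours E x. out_degree E x y = out_degree E x z)"

definition curvature_sharp :: "'a set set \<Rightarrow> 'a \<Rightarrow> ereal \<Rightarrow> bool" where
  "curvature_sharp E x N \<longleftrightarrow>
    curvature E x N = upper_curvature_bound E x - 2 * real (vertex_degree E x) * real_of_ereal (1 / N)"

end

theory Submission
  imports Defs
begin

text \<open>
  Normalise \<open>f x = 0\<close>. Completing squares over the 2-sphere turns \<open>4 * Gamma2 f\<close> into a diagonal
  quadratic form in the values on the 1-sphere plus twice the square of their sum plus a sum \<open>R f\<close>
  of squares, and \<open>R\<close> vanishes to second order at the distance \<open>r\<close> from \<open>x\<close>, capped at 2.
  Testing with \<open>r\<close> gives the upper bound for the curvature. Sharpness makes \<open>r\<close> a null vector of a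
  nonnegative form, so the first variation of the form at \<open>r\<close> in the direction of a neighbour \<open>y\<close>
  vanishes; it is a multiple of the difference between the out degree of \<open>y\<close> and the average.
  Conversely, if all out degrees agree, then for \<open>N = 2\<close> the form at the upper bound is just \<open>R\<close>.
\<close>

section \<open>Preliminaries on quadratic forms\<close>

lemma Gamma1_eq:
  "Gamma1 E f g x = (\<Sum>y\<in>neighbours E x. (f y - f x) * (g y - g x)) / 2"
  unfolding Gamma1_def laplacian_def sum_distrib_left sum_subtractf[symmetric]
  by (intro arg_cong2[where f = "(/)"] sum.cong) (auto simp: algebra_simps)

text \<open>The polynomial is nonnegative and vanishes at 0, so it has a minimum there and its
  derivative at 0 is zero. This extracts the first-variation condition at a null vector.\<close>

lemma linear_coeff_eq_0:
  fixes a b :: real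
  assumes "\<And>t. 0 \<le> a * t + b * t\<^sup>2"
  shows "a = 0"
proof (rule ccontr)
  assume "a \<noteq> 0"
  \<comment> \<open>With |b| = s - 1 the value at t = -a/s is at most exactly -(a/s)^2; the summand
    1 also keeps \<open>s\<close> positive when b = 0.\<close>
  define s where "s = \<bar>b\<bar> + 1"
  define t where "t = - a / s"
  have "s > 0" and b: "\<bar>b\<bar> = s - 1" by (auto simp: s_def)
  have "0 \<le> a * t + b * t\<^sup>2" by (rule assms)
  also have "\<dots> \<le> a * t + \<bar>b\<bar> * t\<^sup>2"
    by (simp add: mult_right_mono)
  also have "\<dots> = - ((a / s)\<^sup>2)"
    using \<open>s > 0\<close> unfolding b by (simp add: t_def field_simps power2_eq_square)
  finally show False using \<open>a \<noteq> 0\<close> \<open>s > 0\<close> by simp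
qed

abbreviation out_neighbours :: "'a set set \<Rightarrow> 'a \<Rightarrow> 'a \<Rightarrow> 'a set" where
  "out_neighbours E x y \<equiv> {z \<in> neighbours E y. graph_distance E x z = 2}"

text \<open>The remainder \<open>R\<close> of the overview. The first double sum runs over ordered
  pairs, so each edge inside the 1-sphere occurs twice. The second collects second differences along
  paths x, y, z leaving the 1-ball.\<close>

definition square_part :: "'a set set \<Rightarrow> 'a \<Rightarrow> ('a \<Rightarrow> real) \<Rightarrow> real" where
  "square_part E x f =
    2 * (\<Sum>y\<in>neighbours E x. \<Sum>z\<in>neighbours E x \<inter> neighbours E y. (f y - f z)\<^sup>2)
    + (\<Sum>y\<in>neighbours E x. \<Sum>z\<in>out_neighbours E x y. (f z - 2 * f y + f x)\<^sup>2)"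

lemma square_part_nonneg: "0 \<le> square_part E x f"
  unfolding square_part_def by (intro add_nonneg_nonneg mult_nonneg_nonneg sum_nonneg) auto

context locally_finite_graph
begin

section \<open>The ball of radius two around a vertex\<close>

lemma neighbours_sym: "y \<in> neighbours E x \<longleftrightarrow> x \<in> neighbours E y"
  by (simp add: neighbours_def insert_commute)

lemma not_neighbour_self: "x \<notin> neighbours E x"
  using edges[of "{x, x}"] by (auto simp: neighbours_def)

lemma neighbour_in_V: "y \<in> neighbours E x \<Longrightarrow> y \<in> V"
  using edges[of "{x, y}"] by (auto simp: neighbours_def)

text \<open>The walk x, y, z bounds the distance by 2, so only walks of length 0 and 1 have to be
  excluded.\<close>

lemma graph_distance_eq_2_iff:
  assumes y: "y \<in> neighbours E x" and z: "z \<in> neighbours E y"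
  shows "graph_distance E x z = 2 \<longleftrightarrow> z \<noteq> x \<and> z \<notin> neighbours E x"
proof -
  define W where "W = {n. (x, z) \<in> {(u, v). {u, v} \<in> E} ^^ n}"
  have dist: "graph_distance E x z = (INF n\<in>W. enat n)"
    by (simp add: graph_distance_def W_def)
  have W0: "0 \<in> W \<longleftrightarrow> z = x" and W1: "1 \<in> W \<longleftrightarrow> z \<in> neighbours E x"
    by (auto simp: W_def neighbours_def)
  have "2 \<in> W"
    using y z by (auto simp: W_def neighbours_def numeral_2_eq_2)
  then have le2: "graph_distance E x z \<le> 2"
    unfolding dist by (metis INF_lower numeral_eq_enat)
  show ?thesis
  proof
    assume eq: "graph_distance E x z = 2"
    have "2 \<le> n" if "n \<in> W" for n
      using INF_lower[OF that, of enat] eq by (simp add: dist numeral_eq_enat)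
    then show "z \<noteq> x \<and> z \<notin> neighbours E x" using W0 W1 by fastforce
  next
    assume "z \<noteq> x \<and> z \<notin> neighbours E x"
    with W0 W1 have "2 \<le> n" if "n \<in> W" for n
      using that by (cases "n = 0 \<or> n = 1") auto
    then have "2 \<le> graph_distance E x z"
      unfolding dist by (intro INF_greatest) (simp add: numeral_eq_enat)
    with le2 show "graph_distance E x z = 2" by simp
  qed
qed

lemma sum_neighbours_split:
  fixes h :: "'a \<Rightarrow> real"
  assumes "x \<in> V" and y: "y \<in> neighbours E x"
  shows "(\<Sum>z\<in>neighbours E y. h z) =
    h x + (\<Sum>z\<in>neighbours E x \<inter> neighbours E y. h z) + (\<Sum>z\<in>out_neighbours E x y. h z)"
proof -
  have fin: "finite (neighbours E y)"
    using y by (intro finite_neighbours neighbour_in_V)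
  have "neighbours E y =
      insert x ((neighbours E x \<inter> neighbours E y) \<union> out_neighbours E x y)"
    using graph_distance_eq_2_iff[OF y] y neighbours_sym by blast
  then have "(\<Sum>z\<in>neighbours E y. h z) =
      (\<Sum>z\<in>insert x ((neighbours E x \<inter> neighbours E y) \<union> out_neighbours E x y). h z)"
    by simp
  also have "\<dots> = h x + (\<Sum>z\<in>(neighbours E x \<inter> neighbours E y) \<union> out_neighbours E x y. h z)"
    using fin graph_distance_eq_2_iff[OF y] not_neighbour_self by (subst sum.insert) auto
  also have "(\<Sum>z\<in>(neighbours E x \<inter> neighbours E y) \<union> out_neighbours E x y. h z) =
      (\<Sum>z\<in>neighbours E x \<inter> neighbours E y. h z) + (\<Sum>z\<in>out_neighbours E x y. h z)"
    using fin graph_distance_eq_2_iff[OF y] by (intro sum.union_disjoint) auto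
  finally show ?thesis by simp
qed

section \<open>\<open>Gamma2\<close> as a diagonal form plus squares\<close>

text \<open>Everything is written in differences to \<open>f x\<close>, which replaces the
  normalisation f x = 0. The degree term comes from subtracting \<open>Gamma1\<close> at x once per
  neighbour, the squared sum from the value of the Laplacian at x in the mixed term.\<close>

lemma Gamma2_eq_double_sum:
  "4 * Gamma2 E f f x =
    (\<Sum>y\<in>neighbours E x. \<Sum>z\<in>neighbours E y.
        (f z - f x)\<^sup>2 - 4 * (f y - f x) * (f z - f x) + 3 * (f y - f x)\<^sup>2)
    - real (vertex_degree E x) * (\<Sum>y\<in>neighbours E x. (f y - f x)\<^sup>2)
    + 2 * (\<Sum>y\<in>neighbours E x. f y - f x)\<^sup>2"
proof -
  let ?S = "\<Sum>y\<in>neighbours E x. f y - f x"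
  let ?Q = "\<Sum>y\<in>neighbours E x. (f y - f x)\<^sup>2"
  have "2 * laplacian E (Gamma1 E f f) x =
      (\<Sum>y\<in>neighbours E x. (\<Sum>z\<in>neighbours E y. (f z - f y)\<^sup>2) - ?Q)"
    unfolding laplacian_def Gamma1_eq sum_distrib_left
    by (intro sum.cong) (simp_all add: power2_eq_square algebra_simps)
  also have "\<dots> = (\<Sum>y\<in>neighbours E x. \<Sum>z\<in>neighbours E y. (f z - f y)\<^sup>2)
      - real (vertex_degree E x) * ?Q"
    by (simp add: sum_subtractf vertex_degree_def)
  finally have 1: "2 * laplacian E (Gamma1 E f f) x = \<dots>" .
  have sym: "Gamma1 E (laplacian E f) f x = Gamma1 E f (laplacian E f) x"
    by (simp add: Gamma1_eq mult.commute)
  have "2 * Gamma1 E f (laplacian E f) x =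
      (\<Sum>y\<in>neighbours E x. (f y - f x) * (laplacian E f y - laplacian E f x))"
    by (simp add: Gamma1_eq)
  also have "\<dots> = (\<Sum>y\<in>neighbours E x. (f y - f x) * laplacian E f y) - ?S * laplacian E f x"
    by (simp only: right_diff_distrib[of "f _ - f x"] sum_subtractf[of "\<lambda>y. (f y - f x) * _ y"]
        sum_distrib_right[symmetric])
  also have "\<dots> = (\<Sum>y\<in>neighbours E x. \<Sum>z\<in>neighbours E y. (f y - f x) * (f z - f y)) - ?S\<^sup>2"
    by (simp add: laplacian_def sum_distrib_left power2_eq_square)
  finally have 2: "2 * Gamma1 E f (laplacian E f) x = \<dots>" .
  \<comment> \<open>With u = f y - f x and w = f z - f x this is w^2 - 4uw + 3u^2 = (w - u)^2 - 2u(w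
    - u).\<close>
  have "(\<Sum>y\<in>neighbours E x. \<Sum>z\<in>neighbours E y.
        (f z - f x)\<^sup>2 - 4 * (f y - f x) * (f z - f x) + 3 * (f y - f x)\<^sup>2) =
      (\<Sum>y\<in>neighbours E x. \<Sum>z\<in>neighbours E y.
        (f z - f y)\<^sup>2 - 2 * ((f y - f x) * (f z - f y)))"
    by (intro sum.cong refl) (simp add: power2_eq_square algebra_simps)
  also have "\<dots> = (\<Sum>y\<in>neighbours E x. \<Sum>z\<in>neighbours E y. (f z - f y)\<^sup>2)
      - 2 * (\<Sum>y\<in>neighbours E x. \<Sum>z\<in>neighbours E y. (f y - f x) * (f z - f y))"
    by (simp only: sum_subtractf sum_distrib_left)
  finally have 3: "(\<Sum>y\<in>neighbours E x. \<Sum>z\<in>neighbours E y.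
        (f z - f x)\<^sup>2 - 4 * (f y - f x) * (f z - f x) + 3 * (f y - f x)\<^sup>2) = \<dots>" .
  have "4 * Gamma2 E f f x =
      2 * laplacian E (Gamma1 E f f) x - 2 * (2 * Gamma1 E f (laplacian E f) x)"
    by (simp add: Gamma2_def sym)
  then show ?thesis unfolding 1 2 3 by simp
qed

text \<open>In the same u and w, the summand w^2 - 4uw + 3u^2 is treated by the position of z. For z
  = x it is 3u^2. On the 2-sphere it is (w - 2u)^2 - u^2, and the lost u^2 accumulates to the out
  degree. On the 1-sphere it is 2(u - w)^2 + (u^2 - w^2), whose last part is antisymmetric and
  cancels over ordered adjacent pairs.\<close>

lemma Gamma2_eq:
  assumes x: "x \<in> V"
  shows "4 * Gamma2 E f f x =
    (\<Sum>y\<in>neighbours E x. (3 - real (vertex_degree E x) - real (out_degree E x y)) * (f y - f x)\<^sup>2)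
    + 2 * (\<Sum>y\<in>neighbours E x. f y - f x)\<^sup>2 + square_part E x f"
proof -
  let ?N = "neighbours E x"
  let ?M = "\<lambda>y. ?N \<inter> neighbours E y"
  let ?h = "\<lambda>y z. (f z - f x)\<^sup>2 - 4 * (f y - f x) * (f z - f x) + 3 * (f y - f x)\<^sup>2"
  have fin: "finite ?N" using x by (rule finite_neighbours)
  have split: "(\<Sum>z\<in>neighbours E y. ?h y z) = 3 * (f y - f x)\<^sup>2 + (\<Sum>z\<in>?M y. ?h y z)
      + ((\<Sum>z\<in>out_neighbours E x y. (f z - 2 * f y + f x)\<^sup>2)
        - real (out_degree E x y) * (f y - f x)\<^sup>2)" if "y \<in> ?N" for y
  proof -
    have "(\<Sum>z\<in>out_neighbours E x y. ?h y z) =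
        (\<Sum>z\<in>out_neighbours E x y. (f z - 2 * f y + f x)\<^sup>2 - (f y - f x)\<^sup>2)"
      by (intro sum.cong refl) (simp add: power2_eq_square algebra_simps)
    then show ?thesis
      unfolding sum_neighbours_split[OF x that] by (simp add: sum_subtractf out_degree_def)
  qed
  have swap: "(\<Sum>y\<in>?N. \<Sum>z\<in>?M y. (f z - f x)\<^sup>2) = (\<Sum>y\<in>?N. \<Sum>z\<in>?M y. (f y - f x)\<^sup>2)"
    using sum.swap_restrict[OF fin fin, of "\<lambda>y z. (f z - f x)\<^sup>2" "\<lambda>y z. z \<in> neighbours E y"]
    by (simp add: Int_def neighbours_sym)
  have "(\<Sum>y\<in>?N. \<Sum>z\<in>?M y. ?h y z) =
      (\<Sum>y\<in>?N. \<Sum>z\<in>?M y. 2 * (f y - f z)\<^sup>2 + ((f y - f x)\<^sup>2 - (f z - f x)\<^sup>2))"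
    by (intro sum.cong refl) (simp add: power2_eq_square algebra_simps)
  also have "\<dots> = 2 * (\<Sum>y\<in>?N. \<Sum>z\<in>?M y. (f y - f z)\<^sup>2)"
    using swap by (simp only: sum.distrib sum_subtractf sum_distrib_left)
  finally have inner: "(\<Sum>y\<in>?N. \<Sum>z\<in>?M y. ?h y z) = \<dots>" .
  define H where "H y = (\<Sum>z\<in>?M y. ?h y z)" for y
  have "(\<Sum>y\<in>?N. \<Sum>z\<in>neighbours E y. ?h y z) =
      (\<Sum>y\<in>?N. 3 * (f y - f x)\<^sup>2 + H y
        + ((\<Sum>z\<in>out_neighbours E x y. (f z - 2 * f y + f x)\<^sup>2)
          - real (out_degree E x y) * (f y - f x)\<^sup>2))"
    unfolding H_def by (intro sum.cong refl split)
  also have "\<dots> =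
      3 * (\<Sum>y\<in>?N. (f y - f x)\<^sup>2) + 2 * (\<Sum>y\<in>?N. \<Sum>z\<in>?M y. (f y - f z)\<^sup>2)
      + (\<Sum>y\<in>?N. \<Sum>z\<in>out_neighbours E x y. (f z - 2 * f y + f x)\<^sup>2)
      - (\<Sum>y\<in>?N. real (out_degree E x y) * (f y - f x)\<^sup>2)"
    using inner unfolding H_def[symmetric]
    by (simp only: sum.distrib sum_subtractf sum_distrib_left[symmetric])
  finally show ?thesis
    unfolding Gamma2_eq_double_sum square_part_def
    by (simp add: left_diff_distrib sum_subtractf sum_distrib_left)
qed

text \<open>Four times the defining inequality. The dimension enters only through the coefficient of
  the squared sum, which vanishes at N = 2.\<close>

lemma curvature_dimension_iff:
  assumes "x \<in> V"
  shows "curvature_dimension E x K N \<longleftrightarrow>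
    (\<forall>f. 0 \<le> (\<Sum>y\<in>neighbours E x.
        (3 - real (vertex_degree E x) - real (out_degree E x y) - 2 * K) * (f y - f x)\<^sup>2)
      + (2 - 4 * real_of_ereal (1 / N)) * (\<Sum>y\<in>neighbours E x. f y - f x)\<^sup>2
      + square_part E x f)"
proof -
  have "real_of_ereal (1 / N) * (laplacian E f x)\<^sup>2 + K * Gamma1 E f f x \<le> Gamma2 E f f x \<longleftrightarrow>
      0 \<le> (\<Sum>y\<in>neighbours E x.
        (3 - real (vertex_degree E x) - real (out_degree E x y) - 2 * K) * (f y - f x)\<^sup>2)
      + (2 - 4 * real_of_ereal (1 / N)) * (\<Sum>y\<in>neighbours E x. f y - f x)\<^sup>2
      + square_part E x f" for f
  proof -
    have "4 * (Gamma2 E f f x - (real_of_ereal (1 / N) * (laplacian E f x)\<^sup>2 + K * Gamma1 E f f x)) =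
      (\<Sum>y\<in>neighbours E x.
        (3 - real (vertex_degree E x) - real (out_degree E x y) - 2 * K) * (f y - f x)\<^sup>2)
      + (2 - 4 * real_of_ereal (1 / N)) * (\<Sum>y\<in>neighbours E x. f y - f x)\<^sup>2
      + square_part E x f"
    proof -
      define S where "S = (\<Sum>y\<in>neighbours E x. f y - f x)"
      define Q where "Q = (\<Sum>y\<in>neighbours E x. (f y - f x)\<^sup>2)"
      define a where "a = (\<lambda>y. 3 - real (vertex_degree E x) - real (out_degree E x y))"
      define P where "P = (\<Sum>y\<in>neighbours E x. a y * (f y - f x)\<^sup>2)"
      have L: "laplacian E f x = S" by (simp add: laplacian_def S_def)
      have G: "Gamma1 E f f x = Q / 2" by (simp add: Gamma1_eq Q_def power2_eq_square)
      have A: "(\<Sum>y\<in>neighbours E x. (a y - 2 * K) * (f y - f x)\<^sup>2) = P - 2 * K * Q"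
        unfolding P_def Q_def
        by (simp only: left_diff_distrib[of "a _"] sum_subtractf sum_distrib_left mult.assoc)
      have "4 * Gamma2 E f f x = P + 2 * S\<^sup>2 + square_part E x f"
        unfolding P_def a_def S_def by (rule Gamma2_eq[OF assms])
      then show ?thesis
        unfolding L G A[unfolded a_def] S_def[symmetric] by (simp add: algebra_simps)
    qed
    moreover have "l \<le> g \<longleftrightarrow> 0 \<le> r" if "4 * (g - l) = r" for l g r :: real
      using that by auto
    ultimately show ?thesis by blast
  qed
  then show ?thesis unfolding curvature_dimension_def by simp
qed

section \<open>Variation at the truncated distance function\<close>

text \<open>Each squared expression is linear in the function and vanishes at \<open>r\<close>: it
  is 1 - 1 inside the 1-sphere and 2 - 2 + 0 towards the 2-sphere. Only the multiple t of the
  indicator of y survives.\<close>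

lemma square_part_perturbation:
  fixes x y :: 'a
  defines "r \<equiv> \<lambda>z. if z = x then 0 else if z \<in> neighbours E x then 1 else (2::real)"
  shows "square_part E x (\<lambda>z. r z + t * of_bool (z = y)) =
    t\<^sup>2 * square_part E x (\<lambda>z. of_bool (z = y))"
proof -
  have "(\<Sum>y'\<in>neighbours E x. \<Sum>z\<in>neighbours E x \<inter> neighbours E y'.
        (r y' + t * of_bool (y' = y) - (r z + t * of_bool (z = y)))\<^sup>2) =
      (\<Sum>y'\<in>neighbours E x. \<Sum>z\<in>neighbours E x \<inter> neighbours E y'.
        t\<^sup>2 * (of_bool (y' = y) - of_bool (z = y))\<^sup>2)"
    using not_neighbour_self by (intro sum.cong refl) (auto simp: r_def)
  moreover have "(\<Sum>y'\<in>neighbours E x. \<Sum>z\<in>out_neighbours E x y'.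
        (r z + t * of_bool (z = y) - 2 * (r y' + t * of_bool (y' = y))
          + (r x + t * of_bool (x = y)))\<^sup>2) =
      (\<Sum>y'\<in>neighbours E x. \<Sum>z\<in>out_neighbours E x y'.
        t\<^sup>2 * (of_bool (z = y) - 2 * of_bool (y' = y) + of_bool (x = y))\<^sup>2)"
    using not_neighbour_self
    by (intro sum.cong refl)
      (auto simp: r_def graph_distance_eq_2_iff power2_eq_square algebra_simps)
  ultimately show ?thesis
    unfolding square_part_def by (simp add: sum_distrib_left algebra_simps)
qed

text \<open>The polynomial is the form of \<open>curvature_dimension_iff\<close> at \<open>r\<close>
  plus t times the indicator of y. Its constant term yields the upper bound, its linear term the
  first variation; \<open>b\<close> stays anonymous because only its existence matters
  afterwards.\<close>

lemma curvature_form_perturbation: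
  assumes x: "x \<in> V" and y: "y \<in> neighbours E x"
    and cd: "curvature_dimension E x K N"
  shows "\<exists>b. \<forall>t. 0 \<le> 2 * real (vertex_degree E x)
      * (upper_curvature_bound E x - 2 * real (vertex_degree E x) * real_of_ereal (1 / N) - K)
    + 2 * (3 + real (vertex_degree E x) - real (out_degree E x y)
        - 4 * real (vertex_degree E x) * real_of_ereal (1 / N) - 2 * K) * t + b * t\<^sup>2"
proof -
  let ?N = "neighbours E x"
  define d where "d = real (vertex_degree E x)"
  define c where "c = real_of_ereal (1 / N)"
  define a where "a = (\<lambda>y'. 3 - d - real (out_degree E x y') - 2 * K)"
  define r where "r = (\<lambda>z. if z = x then 0 else if z \<in> ?N then 1 else (2::real))"
  have fin: "finite ?N" using x by (rule finite_neighbours)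
  have card: "real (card ?N) = d" by (simp add: d_def vertex_degree_def)
  have "d > 0" using y fin by (auto simp: card[symmetric] card_gt_0_iff)
  have "y \<noteq> x" using y not_neighbour_self by blast
  have val: "r z + t * of_bool (z = y) - (r x + t * of_bool (x = y)) = 1 + t * of_bool (z = y)"
    if "z \<in> ?N" for z t
    using that \<open>y \<noteq> x\<close> not_neighbour_self by (auto simp: r_def)
  \<comment> \<open>The term -2d^2 is arranged to cancel the 2d^2 that the squared sum contributes
    at t = 0.\<close>
  have sum_a: "sum a ?N = 2 * d * (upper_curvature_bound E x - K) - 2 * d\<^sup>2"
  proof -
    have "sum a ?N = 3 * d - d\<^sup>2 - (\<Sum>z\<in>?N. real (out_degree E x z)) - 2 * K * d"
      by (simp add: a_def sum_subtractf card power2_eq_square right_diff_distrib)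
    also have "(\<Sum>z\<in>?N. real (out_degree E x z)) = d * average_out_degree E x"
      using \<open>d > 0\<close> by (simp add: average_out_degree_def d_def)
    finally show ?thesis
      by (simp add: upper_curvature_bound_def d_def[symmetric] power2_eq_square algebra_simps
          add_divide_distrib diff_divide_distrib)
  qed
  have "0 \<le> 2 * d * (upper_curvature_bound E x - 2 * d * c - K)
      + 2 * (3 + d - real (out_degree E x y) - 4 * d * c - 2 * K) * t
      + (a y + (2 - 4 * c) + square_part E x (\<lambda>z. of_bool (z = y))) * t\<^sup>2" for t
  proof -
    let ?f = "\<lambda>z. r z + t * of_bool (z = y)"
    have "(\<Sum>z\<in>?N. ?f z - ?f x) = (\<Sum>z\<in>?N. 1 + (if z = y then t else 0))"
      by (intro sum.cong refl) (simp add: val)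
    also have "\<dots> = d + t"
      using fin y by (simp add: sum.distrib card)
    finally have S: "(\<Sum>z\<in>?N. ?f z - ?f x) = d + t" .
    have "(\<Sum>z\<in>?N. a z * (?f z - ?f x)\<^sup>2) =
        (\<Sum>z\<in>?N. a z + (if z = y then a y * (2 * t + t\<^sup>2) else 0))"
      by (intro sum.cong refl) (auto simp: val power2_eq_square algebra_simps)
    also have "\<dots> = sum a ?N + a y * (2 * t + t\<^sup>2)"
      using fin y by (simp add: sum.distrib)
    finally have A: "(\<Sum>z\<in>?N. a z * (?f z - ?f x)\<^sup>2) = \<dots>" .
    have "0 \<le> (\<Sum>z\<in>?N. a z * (?f z - ?f x)\<^sup>2)
        + (2 - 4 * c) * (\<Sum>z\<in>?N. ?f z - ?f x)\<^sup>2 + square_part E x ?f"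
      unfolding a_def c_def d_def
      by (rule cd[unfolded curvature_dimension_iff[OF x], rule_format, of ?f])
    also have "square_part E x ?f = t\<^sup>2 * square_part E x (\<lambda>z. of_bool (z = y))"
      unfolding r_def by (rule square_part_perturbation)
    finally show ?thesis
      unfolding A S sum_a by (simp add: a_def power2_eq_square algebra_simps)
  qed
  then show ?thesis unfolding c_def d_def by blast
qed

section \<open>Upper bound and attainment of the curvature\<close>

lemma curvature_dimension_le:
  assumes "x \<in> V" and "y \<in> neighbours E x" and "curvature_dimension E x K N"
  shows "K \<le> upper_curvature_bound E x - 2 * real (vertex_degree E x) * real_of_ereal (1 / N)"
proof -
  have "real (vertex_degree E x) > 0"
    using assms(1,2) finite_neighbours by (auto simp: vertex_degree_def card_gt_0_iff)
  moreover have "0 \<le> 2 * real (vertex_degree E x)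
      * (upper_curvature_bound E x - 2 * real (vertex_degree E x) * real_of_ereal (1 / N) - K)"
    using curvature_form_perturbation[OF assms] by (auto dest: spec[of _ 0])
  ultimately show ?thesis by (simp add: zero_le_mult_iff)
qed

lemma sum_squared_le:
  assumes "x \<in> V"
  shows "(\<Sum>y\<in>neighbours E x. h y)\<^sup>2
    \<le> real (vertex_degree E x) * (\<Sum>y\<in>neighbours E x. (h y :: real)\<^sup>2)"
  using Cauchy_Schwarz_ineq_sum[of "\<lambda>_. 1" h "neighbours E x"] by (simp add: vertex_degree_def)

lemma curvature_dimension_exists:
  assumes x: "x \<in> V"
  shows "\<exists>K. curvature_dimension E x K N"
proof -
  let ?N = "neighbours E x"
  define d where "d = real (vertex_degree E x)"
  define c where "c = real_of_ereal (1 / N)"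
  define D where "D = (\<Sum>y\<in>?N. real (out_degree E x y))"
  \<comment> \<open>Since \<open>D\<close> dominates every out degree, this choice makes each
    diagonal coefficient at least 4|c|d. By Cauchy-Schwarz that absorbs the term -4c times the
    squared sum.\<close>
  define K where "K = (3 - d - D - 4 * \<bar>c\<bar> * d) / 2"
  have "0 \<le> (\<Sum>y\<in>?N. (3 - d - real (out_degree E x y) - 2 * K) * (f y - f x)\<^sup>2)
      + (2 - 4 * c) * (\<Sum>y\<in>?N. f y - f x)\<^sup>2 + square_part E x f" for f
  proof -
    have "4 * \<bar>c\<bar> * d * (\<Sum>y\<in>?N. (f y - f x)\<^sup>2) = (\<Sum>y\<in>?N. 4 * \<bar>c\<bar> * d * (f y - f x)\<^sup>2)"
      by (rule sum_distrib_left)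
    also have "\<dots> \<le> (\<Sum>y\<in>?N. (3 - d - real (out_degree E x y) - 2 * K) * (f y - f x)\<^sup>2)"
    proof (intro sum_mono mult_right_mono)
      fix y assume "y \<in> ?N"
      then have "real (out_degree E x y) \<le> D"
        unfolding D_def using x finite_neighbours by (intro member_le_sum) auto
      moreover have "2 * K = 3 - d - D - 4 * \<bar>c\<bar> * d" by (simp add: K_def)
      ultimately show "4 * \<bar>c\<bar> * d \<le> 3 - d - real (out_degree E x y) - 2 * K" by linarith
    qed simp
    finally have 1: "4 * \<bar>c\<bar> * d * (\<Sum>y\<in>?N. (f y - f x)\<^sup>2) \<le> \<dots>" .
    have "4 * c * (\<Sum>y\<in>?N. f y - f x)\<^sup>2 \<le> 4 * \<bar>c\<bar> * (\<Sum>y\<in>?N. f y - f x)\<^sup>2"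
      by (intro mult_right_mono) auto
    also have "\<dots> \<le> 4 * \<bar>c\<bar> * (d * (\<Sum>y\<in>?N. (f y - f x)\<^sup>2))"
      unfolding d_def by (intro mult_left_mono sum_squared_le x) auto
    finally have 2: "4 * c * (\<Sum>y\<in>?N. f y - f x)\<^sup>2 \<le> 4 * \<bar>c\<bar> * d * (\<Sum>y\<in>?N. (f y - f x)\<^sup>2)"
      by (simp add: mult.assoc)
    have "0 \<le> (\<Sum>y\<in>?N. f y - f x)\<^sup>2" by simp
    with 1 2 square_part_nonneg[of E x f] show ?thesis
      unfolding left_diff_distrib[of 2] by linarith
  qed
  then show ?thesis
    unfolding curvature_dimension_iff[OF x] d_def c_def by blast
qed

text \<open>The \<open>GREATEST\<close> in \<open>curvature\<close> carries information only if a
  greatest K exists. The admissible K form a nonempty set, bounded above, and closed because each f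
  imposes a closed condition affine in K; so the supremum is attained.\<close>

lemma curvature_dimension_curvature:
  assumes x: "x \<in> V" and y: "y \<in> neighbours E x"
  shows "curvature_dimension E x (curvature E x N) N"
proof -
  define A where "A = {K. curvature_dimension E x K N}"
  have ne: "A \<noteq> {}" using curvature_dimension_exists[OF x] by (simp add: A_def)
  have bdd: "bdd_above A"
    using curvature_dimension_le[OF x y] by (auto simp: A_def bdd_above_def)
  have "A = (\<Inter>f. {K. real_of_ereal (1 / N) * (laplacian E f x)\<^sup>2 + K * Gamma1 E f f x
      \<le> Gamma2 E f f x})"
    by (auto simp: A_def curvature_dimension_def)
  also have "closed \<dots>"
    by (intro closed_INT ballI closed_Collect_le continuous_intros)
  finally have "Sup A \<in> A" using ne bdd closed_contains_Sup by blast
  moreover have "K \<le> Sup A" if "K \<in> A" for K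
    using that bdd by (rule cSup_upper)
  ultimately show ?thesis
    unfolding curvature_def A_def by (metis Greatest_equality mem_Collect_eq)
qed

section \<open>The two implications\<close>

text \<open>At N = 2 the squared sum drops out, and the conjectured sharp value is the upper bound
  minus d. Equal out degrees make every diagonal coefficient zero at this K, leaving the nonnegative
  \<open>square_part\<close>.\<close>

lemma curvature_sharp_2:
  assumes x: "x \<in> V" and y: "y \<in> neighbours E x" and reg: "S1_out_regular E x"
  shows "curvature_sharp E x 2"
proof -
  define d where "d = real (vertex_degree E x)"
  define K where "K = upper_curvature_bound E x - d"
  have "d > 0"
    using x y finite_neighbours by (auto simp: d_def vertex_degree_def card_gt_0_iff)
  have half: "real_of_ereal (1 / 2) = 1 / 2"
    by (metis ereal_divide numeral_eq_ereal one_ereal_def real_of_ereal.simps(1) zero_neq_numeral)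
  have out: "out_degree E x z = out_degree E x y" if "z \<in> neighbours E x" for z
    using reg y that unfolding S1_out_regular_def by blast
  then have "(\<Sum>z\<in>neighbours E x. real (out_degree E x z)) =
      (\<Sum>z\<in>neighbours E x. real (out_degree E x y))"
    by (intro sum.cong refl arg_cong[of _ _ real])
  then have average: "average_out_degree E x = real (out_degree E x y)"
    using \<open>d > 0\<close> by (simp add: average_out_degree_def d_def vertex_degree_def)
  have coeff: "3 - d - real (out_degree E x z) - 2 * K = 0" if "z \<in> neighbours E x" for z
    unfolding K_def upper_curvature_bound_def average d_def[symmetric] out[OF that]
    by (simp add: field_simps)
  have "curvature_dimension E x K 2"
    unfolding curvature_dimension_iff[OF x] half d_def[symmetric]
    by (simp add: coeff square_part_nonneg cong: sum.cong)
  moreover have "K' \<le> K" if "curvature_dimension E x K' 2" for K'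
    using curvature_dimension_le[OF x y that] unfolding half K_def d_def by simp
  ultimately have "curvature E x 2 = K"
    unfolding curvature_def by (rule Greatest_equality)
  then show ?thesis unfolding curvature_sharp_def half K_def d_def by simp
qed

text \<open>Sharpness removes the constant term of the perturbation polynomial, so its linear
  coefficient must vanish. Inserting the sharp value of K cancels the dimension terms and leaves
  twice the average minus the out degree of y.\<close>

lemma out_degree_eq_average:
  assumes x: "x \<in> V" and y: "y \<in> neighbours E x" and sharp: "curvature_sharp E x N"
  shows "real (out_degree E x y) = average_out_degree E x"
proof -
  define d where "d = real (vertex_degree E x)"
  define c where "c = real_of_ereal (1 / N)"
  have K: "curvature E x N = upper_curvature_bound E x - 2 * d * c"
    using sharp by (simp add: curvature_sharp_def c_def d_def)
  obtain b where "\<And>t. 0 \<le> 2 * (3 + d - real (out_degree E x y) - 4 * d * c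
      - 2 * curvature E x N) * t + b * t\<^sup>2"
    using curvature_form_perturbation[OF x y curvature_dimension_curvature[OF x y, of N]]
    unfolding c_def[symmetric] d_def[symmetric] by (auto simp: K)
  then have "2 * (3 + d - real (out_degree E x y) - 4 * d * c - 2 * curvature E x N) = 0"
    by (rule linear_coeff_eq_0)
  then show ?thesis by (simp add: K upper_curvature_bound_def d_def[symmetric] field_simps)
qed

end

theorem corollary5p10:
  fixes V :: "'a set" and E :: "'a set set" and x :: 'a
  assumes "locally_finite_graph V E"
    and "x \<in> V"
    and "vertex_degree E x \<ge> 1"
  shows "S1_out_regular E x \<longleftrightarrow> (\<exists>N :: ereal. 0 < N \<and> curvature_sharp E x N)"
proof -
  interpret locally_finite_graph V E by (rule assms(1))
  \<comment> \<open>A neighbour makes d positive, which is what bounds the admissible K from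
    above.\<close>
  obtain y where y: "y \<in> neighbours E x"
    using assms(3) by (fastforce simp: vertex_degree_def)
  show ?thesis
  proof
    assume "S1_out_regular E x"
    then have "curvature_sharp E x 2" by (rule curvature_sharp_2[OF assms(2) y])
    moreover have "(0::ereal) < 2" by simp
    ultimately show "\<exists>N :: ereal. 0 < N \<and> curvature_sharp E x N" by blast
  next
    assume "\<exists>N :: ereal. 0 < N \<and> curvature_sharp E x N"
    then obtain N where "curvature_sharp E x N" by blast
    then have "real (out_degree E x z) = average_out_degree E x" if "z \<in> neighbours E x" for z
      using assms(2) that by (intro out_degree_eq_average)
    then show "S1_out_regular E x"
      unfolding S1_out_regular_def by (metis of_nat_eq_iff)
  qed
qed

end
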